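(* For every real number $N$, $f_N(1,1)=-N$, and for every integer $x\ge 2$, $$f_N(x,1)=x-1+|N|.$$
   Context: Scoring Nim: fix a real number $N$. A position is a tuple $\boldsymbol p=(p_1,\ldots,p_n)$ of non-negative integers (pile sizes), and $|\boldsymbol p|=\sum_i p_i$. Two players alternate; a move $\boldsymbol p\to\boldsymbol p'$ replaces exactly one coordinate $p_i$ by a strictly smaller non-negative integer. A player gets 1 point per stone taken, and the player taking the last stone gets $N$ additional points. The payoff function $f_N$ (score difference, player to move minus opponent, under optimal play) is defined recursively by $f_N(\boldsymbol 0)=-N$ for the terminal position $\boldsymbol 0=(0,\ldots,0)$, and, for $\boldsymbol p\neq\boldsymbol 0$, $f_N(\boldsymbol p)=\max_{\boldsymbol p\to\boldsymbol p'}\{|\boldsymbol p|-|\boldsymbol p'|-f_N(\boldsymbol p')\}$. *)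

theory Defs
  imports Complex_Main
begin

definition move :: "nat list \<Rightarrow> nat list \<Rightarrow> bool" where
  "move p p' \<longleftrightarrow> (\<exists>i < length p. \<exists>m < p ! i. p' = p[i := m])"

lemma move_sum_list_less:
  assumes "move p p'"
  shows "sum_list p' < sum_list p"
proof -
  from assms obtain i m where i: "i < length p" "m < p ! i" "p' = p[i := m]"
    unfolding move_def by blast
  have "p ! i \<le> sum_list p"
    using i(1) by (rule elem_le_sum_list)
  with i show ?thesis
    by (simp add: sum_list_update)
qed

lemma finite_moves: "finite {p'. move p p'}"
proof -
  have "{p'. move p p'} = (\<Union>i<length p. (\<lambda>m. p[i := m]) ` {..<p ! i})"
    unfolding move_def by auto
  then show ?thesis by simp
qed

lemma ex_move_iff: "(\<exists>p'. move p p') \<longleftrightarrow> p \<noteq> replicate (length p) 0"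
proof -
  have "(\<exists>p'. move p p') \<longleftrightarrow> (\<exists>i < length p. p ! i \<noteq> 0)"
    unfolding move_def by (metis gr_implies_not0 neq0_conv)
  also have "\<dots> \<longleftrightarrow> p \<noteq> replicate (length p) 0"
    by (auto simp: list_eq_iff_nth_eq)
  finally show ?thesis .
qed

text \<open>
  The maximum ranges over a finite set, nonempty at nonterminal positions, by
  \<open>finite_moves\<close> and \<open>ex_move_iff\<close>, so \<^const>\<open>Max\<close> is a genuine maximum.
\<close>

function payoff :: "real \<Rightarrow> nat list \<Rightarrow> real" where
  "payoff N p =
    (if p = replicate (length p) 0 then - N
     else Max ((\<lambda>p'. real (sum_list p) - real (sum_list p') - payoff N p') ` {p'. move p p'}))"
  by pat_completeness auto
termination
  by (relation "measure (\<lambda>(N, p). sum_list p)") (auto simp: move_sum_list_less)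

declare payoff.simps [simp del]

end

theory Submission
  imports Defs
begin

text \<open>
  From \<open>(x, 1)\<close> with \<open>x \<ge> 2\<close>, the moves to \<open>(0, 1)\<close> and \<open>(1, 1)\<close> are worth \<open>x - 1 - N\<close> and
  \<open>x - 1 + N\<close>, because one player is then forced to take the last stone; the better of the two is
  \<open>x - 1 + \<bar>N\<bar>\<close>. No other move is better: one to \<open>(m, 1)\<close> with \<open>m \<ge> 2\<close> hands the opponent the
  same choice, and one to \<open>(x, 0)\<close> lets the opponent take everything.
\<close>

lemma payoff_ge:
  assumes "move p q"
  shows "real (sum_list p) - real (sum_list q) - payoff N q \<le> payoff N p"
proof -
  have "p \<noteq> replicate (length p) 0"
    using assms ex_move_iff by blast
  then have "payoff N p =
      Max ((\<lambda>p'. real (sum_list p) - real (sum_list p') - payoff N p') ` {p'. move p p'})"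
    by (simp add: payoff.simps [of N p])
  then show ?thesis
    using assms by (simp add: finite_moves)
qed

text \<open>The move to \<open>q\<close> certifies that \<open>p\<close> is nonterminal, so the
  \<open>Max\<close> ranges over a nonempty set. With \<open>payoff_ge\<close>, values can be
  computed by antisymmetry.\<close>

lemma payoff_le:
  assumes "move p q"
    and "\<And>p'. move p p' \<Longrightarrow> real (sum_list p) - real (sum_list p') - payoff N p' \<le> v"
  shows "payoff N p \<le> v"
proof -
  have "p \<noteq> replicate (length p) 0"
    using assms(1) ex_move_iff by blast
  then have "payoff N p =
      Max ((\<lambda>p'. real (sum_list p) - real (sum_list p') - payoff N p') ` {p'. move p p'})"
    by (simp add: payoff.simps [of N p])
  then show ?thesis
    using assms by (auto simp: finite_moves intro!: Max.boundedI)
qed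

lemma move_two_piles_iff:
  "move [a, b] q \<longleftrightarrow> (\<exists>m<a. q = [m, b]) \<or> (\<exists>m<b. q = [a, m])"
  unfolding move_def by (auto simp: less_Suc_eq)

lemma payoff_zero_zero: "payoff N [0, 0] = - N"
  by (simp add: payoff.simps)

lemma payoff_one_zero: "payoff N [1, 0] = 1 + N"
proof (rule antisym)
  show "payoff N [1, 0] \<le> 1 + N"
    by (rule payoff_le [of _ "[0, 0]"]) (auto simp: move_two_piles_iff payoff_zero_zero)
  show "1 + N \<le> payoff N [1, 0]"
    using payoff_ge [of "[1, 0]" "[0, 0]" N] by (simp add: move_two_piles_iff payoff_zero_zero)
qed

lemma payoff_zero_one: "payoff N [0, 1] = 1 + N"
proof (rule antisym)
  show "payoff N [0, 1] \<le> 1 + N"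
    by (rule payoff_le [of _ "[0, 0]"]) (auto simp: move_two_piles_iff payoff_zero_zero)
  show "1 + N \<le> payoff N [0, 1]"
    using payoff_ge [of "[0, 1]" "[0, 0]" N] by (simp add: move_two_piles_iff payoff_zero_zero)
qed

text \<open>Either move takes one stone and leaves a single one, worth \<open>1 + N\<close> to the
  opponent.\<close>

lemma payoff_one_one: "payoff N [1, 1] = - N"
proof (rule antisym)
  show "payoff N [1, 1] \<le> - N"
    using payoff_one_zero [of N] payoff_zero_one [of N]
    by (intro payoff_le [of _ "[0, 1]"]) (auto simp: move_two_piles_iff)
  show "- N \<le> payoff N [1, 1]"
    using payoff_ge [of "[1, 1]" "[0, 1]" N] payoff_zero_one [of N]
    by (simp add: move_two_piles_iff)
qed

text \<open>Taking the whole pile earns this much. A lower bound suffices, as the value is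
  subtracted when the move from \<open>[x, 1]\<close> to \<open>[x, 0]\<close> is bounded.\<close>

lemma payoff_single_pile_ge:
  assumes "x > 0"
  shows "real x + N \<le> payoff N [x, 0]"
  using payoff_ge [of "[x, 0]" "[0, 0]" N] assms
  by (simp add: move_two_piles_iff payoff_zero_zero)

lemma payoff_pile_one:
  assumes "x \<ge> 2"
  shows "payoff N [x, 1] = real x - 1 + \<bar>N\<bar>"
  using assms
proof (induction x rule: less_induct)
  case (less x)
  show ?case
  proof (rule antisym)
    show "payoff N [x, 1] \<le> real x - 1 + \<bar>N\<bar>"
    proof (rule payoff_le)
      show "move [x, 1] [x, 0]"
        by (simp add: move_two_piles_iff)
      fix q assume "move [x, 1] q"
      then consider "q = [0, 1]" | "q = [1, 1]" | m where "2 \<le> m" "m < x" "q = [m, 1]"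
        | "q = [x, 0]"
        unfolding move_two_piles_iff
        by (metis One_nat_def Suc_1 Suc_leI less_Suc0 linorder_neqE_nat)
      then show "real (sum_list [x, 1]) - real (sum_list q) - payoff N q \<le> real x - 1 + \<bar>N\<bar>"
      proof cases
        case 1
        then show ?thesis using payoff_zero_one [of N] by simp
      next
        case 2
        then show ?thesis using payoff_one_one [of N] by simp
      next
        case (3 m)
        \<comment> \<open>The move is worth \<open>(x - m) - (m - 1 + \<bar>N\<bar>)\<close>, and
          \<open>m \<ge> 2\<close>.\<close>
        then show ?thesis using less.IH [of m] by simp
      next
        case 4
        \<comment> \<open>The move is worth at most \<open>1 - x - N\<close>, where
          \<open>1 - x \<le> x - 1\<close> and \<open>- N \<le> \<bar>N\<bar>\<close>.\<close>
        then show ?thesis using payoff_single_pile_ge [of x N] less.prems by simp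
      qed
    qed
    show "real x - 1 + \<bar>N\<bar> \<le> payoff N [x, 1]"
      using payoff_ge [of "[x, 1]" "[0, 1]" N] payoff_ge [of "[x, 1]" "[1, 1]" N]
        payoff_zero_one [of N] payoff_one_one [of N] less.prems
      by (simp add: move_two_piles_iff)
  qed
qed

theorem proposition3:
  fixes N :: real
  shows "payoff N [1, 1] = - N \<and> (\<forall>x::nat. x \<ge> 2 \<longrightarrow> payoff N [x, 1] = real x - 1 + \<bar>N\<bar>)"
  using payoff_one_one payoff_pile_one by blast

end
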